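(* Let $\Lambda:=\{(a,b,c)\in\mathbb{R}^3: a,b,c\in2\mathbb{Z},\ a+b+c\in4\mathbb{Z}\}$, with dual lattice $\Lambda^*=\{(a,b,c)\in(\tfrac14\mathbb{Z})^3: a+b,\,a+c,\,b+c\in\tfrac12\mathbb{Z}\}$ (where $(a,b,c)$ denotes the functional $(x,y,z)\mapsto ax+by+cz$). For $(x,y,z)\in\mathbb{R}^3$ let $\Delta(x,y,z)$ be the tetrahedron with vertices $(x,y,z)$, $(-y,x,-z)$, $(-x,-y,z)$, $(y,-x,-z)$. Let $(x,y,z)\in\mathbb{R}^3$ satisfy \[z=\frac{x^2+y^2}{x^2+y^2-2x-2y}.\] Then the lattice width of $\Delta(x,y,z)$ with respect to $\Lambda$ is at most $2+\sqrt2$, with equality if and only if \[(x,y,z)\in\left\{\left(2+\sqrt2,\ \sqrt2,\ 2+\sqrt2\right),\ \left(\sqrt2,\ 2+\sqrt2,\ 2+\sqrt2\right)\right\}.\]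
   Context: The lattice width of a convex body $K$ with respect to $\Lambda$ is $\inf_{f\in\Lambda^*\setminus\{0\}}(\max_K f-\min_K f)$. *)

theory Defs
  imports "HOL-Analysis.Analysis"
begin

text \<open>Linear functionals are identified with vectors through the inner product. For a lattice
  \<open>L\<close> of full rank, the set below is the usual dual lattice.\<close>

definition dual_lattice :: "'a::euclidean_space set \<Rightarrow> 'a set" where
  "dual_lattice L = {f. \<forall>v\<in>L. f \<bullet> v \<in> \<int>}"

text \<open>For a convex body \<open>K\<close> (nonempty and compact) the inner supremum and infimum are attained,
  so they are the maximum and minimum of the functional \<open>f\<close> on \<open>K\<close>.\<close>

definition lattice_width :: "'a::euclidean_space set \<Rightarrow> 'a set \<Rightarrow> real" where
  "lattice_width L K =
     (INF f\<in>dual_lattice L - {0}. (SUP v\<in>K. f \<bullet> v) - (INF v\<in>K. f \<bullet> v))"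

definition Lambda :: "(real^3) set" where
  "Lambda = {vector [a, b, c] | a b c.
     a \<in> (*) 2 ` \<int> \<and> b \<in> (*) 2 ` \<int> \<and> c \<in> (*) 2 ` \<int> \<and> a + b + c \<in> (*) 4 ` \<int>}"

definition tetrahedron :: "real \<Rightarrow> real \<Rightarrow> real \<Rightarrow> (real^3) set" where
  "tetrahedron x y z = convex hull
     {vector [x, y, z], vector [- y, x, - z], vector [- x, - y, z], vector [y, - x, - z]}"

lemma inner_vector_3:
  "(vector [a, b, c] :: real^3) \<bullet> vector [a', b', c'] = a * a' + b * b' + c * c'"
  by (simp add: inner_vec_def sum_3)

lemma dual_lattice_Lambda:
  "dual_lattice Lambda = {vector [a, b, c] | a b c.
     a \<in> (*) (1/4) ` \<int> \<and> b \<in> (*) (1/4) ` \<int> \<and> c \<in> (*) (1/4) ` \<int> \<and>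
     a + b \<in> (*) (1/2) ` \<int> \<and> a + c \<in> (*) (1/2) ` \<int> \<and> b + c \<in> (*) (1/2) ` \<int>}"
  (is "_ = ?D")
proof (intro equalityI subsetI)
  have scaled: "t \<in> (*) (1/r) ` \<int>" if "r * t \<in> \<int>" "r \<noteq> 0" for r t :: real
    using that by (intro image_eqI[of _ _ "r * t"]) auto
  fix f :: "real^3"
  assume f: "f \<in> dual_lattice Lambda"
  define a b c where "a = f $ 1" and "b = f $ 2" and "c = f $ 3"
  have f_eq: "f = vector [a, b, c]"
    by (simp add: vec_eq_iff forall_3 a_def b_def c_def)
  have int: "a * p + b * q + c * r \<in> \<int>"
    if "p \<in> (*) 2 ` \<int>" "q \<in> (*) 2 ` \<int>" "r \<in> (*) 2 ` \<int>" "p + q + r \<in> (*) 4 ` \<int>" for p q r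
  proof -
    have "vector [p, q, r] \<in> Lambda"
      using that unfolding Lambda_def by blast
    with f have "f \<bullet> vector [p, q, r] \<in> \<int>"
      unfolding dual_lattice_def by blast
    then show ?thesis
      by (simp add: f_eq inner_vector_3)
  qed
  have mem: "0 \<in> (*) 2 ` (\<int>::real set)" "2 \<in> (*) 2 ` (\<int>::real set)"
    "4 \<in> (*) 2 ` (\<int>::real set)" "4 \<in> (*) 4 ` (\<int>::real set)"
    by (auto intro: image_eqI[of _ _ 0] image_eqI[of _ _ 1] image_eqI[of _ _ 2])
  have "4 * a \<in> \<int>" "4 * b \<in> \<int>" "4 * c \<in> \<int>"
    using int[OF mem(3,1,1)] int[OF mem(1,3,1)] int[OF mem(1,1,3)] mem(4)
    by (simp_all add: mult.commute)
  moreover have "2 * (a + b) \<in> \<int>" "2 * (a + c) \<in> \<int>" "2 * (b + c) \<in> \<int>"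
    using int[OF mem(2,2,1)] int[OF mem(2,1,2)] int[OF mem(1,2,2)] mem(4)
    by (simp_all add: algebra_simps)
  ultimately have "a \<in> (*) (1/4) ` \<int> \<and> b \<in> (*) (1/4) ` \<int> \<and> c \<in> (*) (1/4) ` \<int> \<and>
     a + b \<in> (*) (1/2) ` \<int> \<and> a + c \<in> (*) (1/2) ` \<int> \<and> b + c \<in> (*) (1/2) ` \<int>"
    by (intro conjI scaled) simp_all
  then show "f \<in> ?D"
    unfolding f_eq by blast
next
  fix f :: "real^3"
  assume "f \<in> ?D"
  then obtain a b c where f_eq: "f = vector [a, b, c]"
    and "a \<in> (*) (1/4) ` \<int>" "a + b \<in> (*) (1/2) ` \<int>" "a + c \<in> (*) (1/2) ` \<int>"
    by blast
  then have ints: "4 * a \<in> \<int>" "2 * (a + b) \<in> \<int>" "2 * (a + c) \<in> \<int>"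
    by (auto simp: algebra_simps)
  show "f \<in> dual_lattice Lambda"
    unfolding dual_lattice_def
  proof safe
    fix v assume "v \<in> Lambda"
    then obtain p q r k where v_eq: "v = vector [p, 2 * q, 2 * r]"
      and qrk: "q \<in> \<int>" "r \<in> \<int>" "k \<in> \<int>" and sum: "p + 2 * q + 2 * r = 4 * k"
      unfolding Lambda_def by blast
    have "f \<bullet> v = a * p + b * (2 * q) + c * (2 * r)"
      by (simp add: f_eq v_eq inner_vector_3)
    also have "p = 4 * k - 2 * q - 2 * r"
      using sum by simp
    also have "a * (4 * k - 2 * q - 2 * r) + b * (2 * q) + c * (2 * r)
        = 4 * a * k + 2 * (a + b) * q + 2 * (a + c) * r - 4 * a * q - 4 * a * r"
      by (simp add: algebra_simps)
    also have "\<dots> \<in> \<int>"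
      using ints qrk by (metis Ints_add Ints_diff Ints_mult)
    finally show "f \<bullet> v \<in> \<int>" .
  qed
qed

end

theory Submission
  imports Defs
begin

text \<open>Writing \<open>u = a x + b y\<close> and \<open>v = b x - a y\<close>, the functional \<open>(a, b, c)\<close> takes the values
  \<open>c z \<plusminus> u\<close> and \<open>- c z \<plusminus> v\<close> at the vertices, so its width is
  \<open>max (2 \<bar>u\<bar>) (2 \<bar>v\<bar>) (2 \<bar>c z\<bar> + \<bar>u\<bar> + \<bar>v\<bar>)\<close>. The functionals \<open>(1/2, 0, 0)\<close> and \<open>(0, 0, 1/2)\<close> already
  bound the lattice width by \<open>min (max \<bar>x\<bar> \<bar>y\<bar>) \<bar>z\<bar>\<close>. On the surface, \<open>z \<ge> 2 + sqrt 2\<close>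
  confines \<open>(x, y)\<close> to the disk of centre \<open>(sqrt 2, sqrt 2)\<close> and radius \<open>2\<close>, where
  \<open>max \<bar>x\<bar> \<bar>y\<bar> \<ge> 2 + sqrt 2\<close> holds at two points of tangency only, and \<open>z \<le> - (2 + sqrt 2)\<close>
  forces \<open>max \<bar>x\<bar> \<bar>y\<bar> < 2 + sqrt 2\<close>.\<close>

lemma SUP_inner_convex_hull:
  fixes f :: "'a::euclidean_space"
  assumes "finite S" "S \<noteq> {}"
  shows "(SUP v\<in>convex hull S. f \<bullet> v) = Max ((\<bullet>) f ` S)"
proof (rule cSup_eq_maximum)
  show "Max ((\<bullet>) f ` S) \<in> (\<bullet>) f ` (convex hull S)"
    using Max_in[of "(\<bullet>) f ` S"] assms hull_subset[of S convex] by blast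
  have "S \<subseteq> {v. f \<bullet> v \<le> Max ((\<bullet>) f ` S)}"
    using assms by auto
  then have "convex hull S \<subseteq> {v. f \<bullet> v \<le> Max ((\<bullet>) f ` S)}"
    by (rule hull_minimal) (rule convex_halfspace_le)
  then show "t \<le> Max ((\<bullet>) f ` S)" if "t \<in> (\<bullet>) f ` (convex hull S)" for t
    using that by blast
qed

lemma INF_inner_convex_hull:
  fixes f :: "'a::euclidean_space"
  assumes "finite S" "S \<noteq> {}"
  shows "(INF v\<in>convex hull S. f \<bullet> v) = Min ((\<bullet>) f ` S)"
proof (rule cInf_eq_minimum)
  show "Min ((\<bullet>) f ` S) \<in> (\<bullet>) f ` (convex hull S)"
    using Min_in[of "(\<bullet>) f ` S"] assms hull_subset[of S convex] by blast
  have "S \<subseteq> {v. f \<bullet> v \<ge> Min ((\<bullet>) f ` S)}"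
    using assms by auto
  then have "convex hull S \<subseteq> {v. f \<bullet> v \<ge> Min ((\<bullet>) f ` S)}"
    by (rule hull_minimal) (rule convex_halfspace_ge)
  then show "Min ((\<bullet>) f ` S) \<le> t" if "t \<in> (\<bullet>) f ` (convex hull S)" for t
    using that by blast
qed

lemma width_tetrahedron:
  "(SUP v\<in>tetrahedron x y z. vector [a, b, c] \<bullet> v) - (INF v\<in>tetrahedron x y z. vector [a, b, c] \<bullet> v)
    = max (2 * max \<bar>a * x + b * y\<bar> \<bar>b * x - a * y\<bar>)
        (2 * \<bar>c * z\<bar> + \<bar>a * x + b * y\<bar> + \<bar>b * x - a * y\<bar>)"
proof -
  define u v w where "u = a * x + b * y" and "v = b * x - a * y" and "w = c * z"
  have vals: "(\<bullet>) (vector [a, b, c]) ` {vector [x, y, z], vector [- y, x, - z],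
      vector [- x, - y, z], vector [y, - x, - z] :: real^3} = {w + u, v - w, w - u, - v - w}"
    by (simp add: inner_vector_3 u_def v_def w_def algebra_simps)
  \<comment> \<open>Max minus Min is the largest pairwise difference: 2|u| and 2|v| inside the two
    pairs, and 2|w| + |u| + |v| over all signs across them.\<close>
  have "Max {w + u, v - w, w - u, - v - w} - Min {w + u, v - w, w - u, - v - w}
      = max (2 * max \<bar>u\<bar> \<bar>v\<bar>) (2 * \<bar>w\<bar> + \<bar>u\<bar> + \<bar>v\<bar>)"
    by (simp add: max_def min_def abs_if)
  then show ?thesis
    unfolding tetrahedron_def u_def[symmetric] v_def[symmetric] w_def[symmetric]
    by (subst SUP_inner_convex_hull, simp, simp, subst INF_inner_convex_hull, simp, simp)
      (simp only: vals)
qed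

text \<open>Four times a dual vector is an integer vector whose entries share one parity; the lower
  bound for the width is a case analysis on these integers.\<close>

lemma dual_lattice_LambdaE:
  assumes "f \<in> dual_lattice Lambda"
  obtains i j k :: int where "f = vector [i / 4, j / 4, k / 4]" "even (i + j)" "even (i + k)"
proof -
  from assms obtain a b c where f: "f = vector [a, b, c]"
    and "a \<in> (*) (1/4) ` \<int>" "b \<in> (*) (1/4) ` \<int>" "c \<in> (*) (1/4) ` \<int>"
    and "a + b \<in> (*) (1/2) ` \<int>" "a + c \<in> (*) (1/2) ` \<int>"
    unfolding dual_lattice_Lambda by blast
  then obtain i j k m n :: int where "a = i / 4" "b = j / 4" "c = k / 4"
    "a + b = m / 2" "a + c = n / 2"
    by (auto elim!: Ints_cases)
  moreover from this have "real_of_int (i + j) = real_of_int (2 * m)"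
    "real_of_int (i + k) = real_of_int (2 * n)"
    by simp_all
  then have "even (i + j)" "even (i + k)"
    by (metis dvd_triv_left of_int_eq_iff)+
  ultimately show thesis
    using that f by blast
qed

lemma lattice_width_tetrahedron_le:
  "lattice_width Lambda (tetrahedron x y z) \<le> min (max \<bar>x\<bar> \<bar>y\<bar>) \<bar>z\<bar>"
proof -
  let ?W = "\<lambda>f. (SUP v\<in>tetrahedron x y z. f \<bullet> v) - (INF v\<in>tetrahedron x y z. f \<bullet> v)"
  \<comment> \<open>An infimum of reals lies below its members only for a family bounded below; 0 is
    such a bound.\<close>
  have "0 \<le> ?W f" if "f \<in> dual_lattice Lambda" for f
    using that by (rule dual_lattice_LambdaE) (simp add: width_tetrahedron le_max_iff_disj)
  then have bdd: "bdd_below (?W ` (dual_lattice Lambda - {0}))"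
    by (intro bdd_belowI2[of _ 0]) auto
  have half: "1 / 2 \<in> (*) (1 / 4) ` (\<int>::real set)" "1 / 2 \<in> (*) (1 / 2) ` (\<int>::real set)"
    and zero: "0 \<in> (*) (1 / 4) ` (\<int>::real set)" "0 \<in> (*) (1 / 2) ` (\<int>::real set)"
    by (auto intro: image_eqI[of _ _ 0] image_eqI[of _ _ 1] image_eqI[of _ _ 2])
  have "vector [1 / 2, 0, 0] \<in> dual_lattice Lambda" "vector [0, 0, 1 / 2] \<in> dual_lattice Lambda"
    unfolding dual_lattice_Lambda using half zero by fastforce+
  moreover have "vector [1 / 2, 0, 0] \<noteq> (0 :: real^3)" "vector [0, 0, 1 / 2] \<noteq> (0 :: real^3)"
    by (simp_all add: vec_eq_iff forall_3)
  ultimately have "lattice_width Lambda (tetrahedron x y z) \<le> ?W (vector [1 / 2, 0, 0])"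
    "lattice_width Lambda (tetrahedron x y z) \<le> ?W (vector [0, 0, 1 / 2])"
    unfolding lattice_width_def by (auto intro!: cINF_lower[OF bdd])
  then show ?thesis
    unfolding width_tetrahedron by (auto simp: max_def abs_if split: if_splits)
qed

lemma surface_height_ge_imp:
  fixes x y z :: real
  assumes q: "x^2 + y^2 - 2 * x - 2 * y \<noteq> 0"
    and z: "z = (x^2 + y^2) / (x^2 + y^2 - 2 * x - 2 * y)"
    and M: "2 + sqrt 2 \<le> max \<bar>x\<bar> \<bar>y\<bar>" and Z: "2 + sqrt 2 \<le> \<bar>z\<bar>"
  shows "(x, y, z) \<in> {(2 + sqrt 2, sqrt 2, 2 + sqrt 2), (sqrt 2, 2 + sqrt 2, 2 + sqrt 2)}"
proof -
  define r where "r = sqrt (2::real)"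
  have r2: "r * r = 2" and r1: "1 < r" by (simp_all add: r_def)
  define q where "q = x^2 + y^2 - 2 * x - 2 * y"
  have zq: "z * q = q + 2 * (x + y)"
    using z q by (simp add: q_def field_simps)
  have circle: "(x - 1)^2 + (y - 1)^2 = q + 2"
    by (simp add: q_def power2_eq_square algebra_simps)
  \<comment> \<open>If \<open>q \<le> 0\<close>, the point lies in the disk of centre (1, 1) and
    radius \<open>r\<close>, so both coordinates are at most 1 + \<open>r\<close> in absolute value,
    against \<open>M\<close>. This excludes negative \<open>z\<close>.\<close>
  have "q > 0"
  proof (rule ccontr)
    assume "\<not> q > 0"
    then have "(x - 1)^2 + (y - 1)^2 \<le> r^2"
      using circle r2 by (simp add: power2_eq_square)
    then have "\<bar>x - 1\<bar> \<le> \<bar>r\<bar>" "\<bar>y - 1\<bar> \<le> \<bar>r\<bar>"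
      unfolding abs_le_square_iff
      by (smt (verit) zero_le_power2)+
    with M r1 show False by (simp add: r_def abs_if max_def split: if_splits)
  qed
  have "z \<ge> 0"
    using \<open>q > 0\<close> z by (simp add: q_def)
  with Z have "2 + r \<le> z" by (simp add: r_def)
  then have "(2 + r) * q \<le> q + 2 * (x + y)"
    using \<open>q > 0\<close> zq by (metis mult_right_mono less_imp_le)
  then have "(1 + r) * q \<le> 2 * (x + y)" by (simp add: algebra_simps)
  \<comment> \<open>Since (r - 1)(r + 1) = 1, this gives q \<le> 2(r - 1)(x + y), that is x^2 + y^2
    \<le> 2r(x + y); completing squares yields the disk.\<close>
  then have "(r - 1) * ((1 + r) * q) \<le> (r - 1) * (2 * (x + y))"
    using r1 by (intro mult_left_mono) auto
  moreover have "(r - 1) * ((1 + r) * q) = q"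
    using r2 by (simp add: algebra_simps)
  ultimately have disk: "(x - r)^2 + (y - r)^2 \<le> 2^2"
    using r2 unfolding q_def by (simp add: power2_eq_square algebra_simps)
  have "\<bar>x - r\<bar> \<le> \<bar>2\<bar>" "\<bar>y - r\<bar> \<le> \<bar>2\<bar>"
    unfolding abs_le_square_iff using disk by (smt (verit) zero_le_power2)+
  \<comment> \<open>Both coordinates lie in [r - 2, r + 2], so \<open>M\<close> can only be met at
    the right end, and there the disk fixes the other coordinate.\<close>
  with M r1 have "x = 2 + r \<or> y = 2 + r"
    by (auto simp: r_def[symmetric] abs_if max_def split: if_splits)
  with disk have xy: "x = 2 + r \<and> y = r \<or> x = r \<and> y = 2 + r" by auto
  then have "q = 4"
    unfolding q_def using r2 by (auto simp: power2_eq_square algebra_simps)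
  with zq xy have "z = 2 + r" by auto
  with xy show ?thesis by (auto simp: r_def)
qed

lemma lattice_width_tetrahedron_extremal:
  assumes xy: "x = 2 + sqrt 2 \<and> y = sqrt 2 \<or> x = sqrt 2 \<and> y = 2 + sqrt 2"
  shows "2 + sqrt 2 \<le> lattice_width Lambda (tetrahedron x y (2 + sqrt 2))"
  unfolding lattice_width_def
proof (rule cINF_greatest)
  have "(vector [1 / 2, 0, 0] :: real^3) \<in> dual_lattice Lambda - {0}"
    unfolding dual_lattice_Lambda
    by (force simp: vec_eq_iff forall_3 intro: image_eqI[of _ _ 0] image_eqI[of _ _ 1]
        image_eqI[of _ _ 2])
  then show "dual_lattice Lambda - {0} \<noteq> {}" by blast
next
  fix f assume f: "f \<in> dual_lattice Lambda - {0}"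
  then obtain i j k :: int where f_eq: "f = vector [i / 4, j / 4, k / 4]"
    and par: "even (i + j)" "even (i + k)"
    by (blast elim: dual_lattice_LambdaE)
  have nz: "\<not> (i = 0 \<and> j = 0 \<and> k = 0)"
    using f f_eq by (auto simp: vec_eq_iff forall_3)
  define r where "r = sqrt (2::real)"
  have r2: "r * r = 2" and r1: "1 < r" by (simp_all add: r_def)
  define U V where "U = \<bar>i * x + j * y\<bar>" and "V = \<bar>j * x - i * y\<bar>"
  \<comment> \<open>The three terms of the width are U/2, V/2 and |k|(2 + r)/2 + (U + V)/4; one of
    them must reach 2 + r.\<close>
  have "2 * (2 + r) \<le> U \<or> 2 * (2 + r) \<le> V \<or> 4 * (2 + r) \<le> 2 * \<bar>k\<bar> * (2 + r) + U + V"
  proof -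
    \<comment> \<open>The threshold 8 leaves, by parity, only (\<plusminus>2, 0) and (0,
      \<plusminus>2) for k = 0, and (\<plusminus>1, \<plusminus>1) for |k| = 1.\<close>
    consider "\<bar>k\<bar> \<ge> 2" | "i^2 + j^2 \<ge> 8" | "\<bar>k\<bar> < 2" "i^2 + j^2 < 8" by linarith
    then show ?thesis
    proof cases
      case 1
      then have "2 * (2 + r) \<le> \<bar>k\<bar> * (2 + r)"
        using r1 by (intro mult_right_mono) auto
      moreover have "0 \<le> U" "0 \<le> V" by (simp_all add: U_def V_def)
      ultimately show ?thesis by linarith
    next
      case 2
      \<comment> \<open>(x, y) is mapped to (ix + jy, jx - iy) by a similarity. Here U^2 + V^2 is at
        least 64 + 32r, while U, V < 2(2 + r) would keep it below 48 + 32r.\<close>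
      have "U^2 + V^2 = (i^2 + j^2) * (x^2 + y^2)"
        by (simp add: U_def V_def power2_eq_square algebra_simps)
      moreover have "x^2 + y^2 = 8 + 4 * r"
        using xy r2 by (auto simp: r_def[symmetric] power2_eq_square algebra_simps)
      moreover have "8 \<le> real_of_int (i^2 + j^2)"
        using 2 by (metis of_int_le_iff of_int_numeral)
      then have "8 * (8 + 4 * r) \<le> (i^2 + j^2) * (8 + 4 * r)"
        using r1 by (intro mult_right_mono) auto
      ultimately have "8 * (8 + 4 * r) \<le> U^2 + V^2" by simp
      moreover have "U^2 + V^2 < (2 * (2 + r))^2 + (2 * (2 + r))^2"
        if "U < 2 * (2 + r)" "V < 2 * (2 + r)"
        using that by (intro add_strict_mono power_strict_mono) (auto simp: U_def V_def)
      ultimately show ?thesis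
        using r2 by (force simp: power2_eq_square algebra_simps)
    next
      case 3
      have "\<bar>i\<bar> < 3" "\<bar>j\<bar> < 3"
        using 3(2) abs_le_square_iff[of 3 i, simplified] abs_le_square_iff[of 3 j, simplified]
          zero_le_power2[of i] zero_le_power2[of j] by linarith+
      then have ij: "i \<in> {-2,-1,0,1,2}" "j \<in> {-2,-1,0,1,2}" by auto
      have "k = 0 \<or> \<bar>k\<bar> = 1" using 3(1) by linarith
      then show ?thesis
      proof
        assume "k = 0"
        with par ij have "i \<in> {-2,0,2}" "j \<in> {-2,0,2}" by auto
        with nz 3(2) \<open>k = 0\<close> have "\<bar>i\<bar> = 2 \<and> j = 0 \<or> i = 0 \<and> \<bar>j\<bar> = 2" by auto
        then have "U = 2 * \<bar>x\<bar> \<or> V = 2 * \<bar>x\<bar>" "U = 2 * \<bar>y\<bar> \<or> V = 2 * \<bar>y\<bar>"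
          unfolding U_def V_def abs_eq_iff' by auto
        with xy show ?thesis unfolding r_def by auto
      next
        assume k: "\<bar>k\<bar> = 1"
        then have "odd k" by (metis dvd_abs_iff odd_one)
        with par ij have "i \<in> {-1,1}" "j \<in> {-1,1}" by auto
        \<comment> \<open>U and V are |x + y| and |x - y| in some order. The third alternative then
          holds with equality.\<close>
        then have "U + V = 2 * max \<bar>x\<bar> \<bar>y\<bar>"
          unfolding U_def V_def by (elim insertE emptyE; simp add: max_def abs_if)
        also have "max \<bar>x\<bar> \<bar>y\<bar> = 2 + r" using xy unfolding r_def by auto
        finally show ?thesis using k by simp
      qed
    qed
  qed
  moreover have "\<bar>i / 4 * x + j / 4 * y\<bar> = U / 4" "\<bar>j / 4 * x - i / 4 * y\<bar> = V / 4"
    "\<bar>k / 4 * (2 + sqrt 2)\<bar> = \<bar>k\<bar> * (2 + r) / 4"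
    using r1 by (auto simp: U_def V_def r_def abs_mult add_divide_distrib[symmetric]
        diff_divide_distrib[symmetric])
  ultimately show "2 + sqrt 2 \<le> (SUP v\<in>tetrahedron x y (2 + sqrt 2). f \<bullet> v) -
      (INF v\<in>tetrahedron x y (2 + sqrt 2). f \<bullet> v)"
    unfolding f_eq width_tetrahedron r_def[symmetric] by (auto simp: max_def)
qed

theorem theorem5p1:
  fixes x y z :: real
  assumes "x^2 + y^2 - 2 * x - 2 * y \<noteq> 0"
    and "z = (x^2 + y^2) / (x^2 + y^2 - 2 * x - 2 * y)"
  shows "lattice_width Lambda (tetrahedron x y z) \<le> 2 + sqrt 2 \<and>
    (lattice_width Lambda (tetrahedron x y z) = 2 + sqrt 2 \<longleftrightarrow>
      (x, y, z) \<in> {(2 + sqrt 2, sqrt 2, 2 + sqrt 2), (sqrt 2, 2 + sqrt 2, 2 + sqrt 2)})"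
    (is "?w \<le> _ \<and> (_ \<longleftrightarrow> ?extremal)")
proof (cases ?extremal)
  case True
  then have "2 + sqrt 2 \<le> ?w"
    using lattice_width_tetrahedron_extremal[of x y] by auto
  moreover have "?w \<le> 2 + sqrt 2"
    using lattice_width_tetrahedron_le[of x y z] True by auto
  ultimately show ?thesis using True by simp
next
  case False
  then have "min (max \<bar>x\<bar> \<bar>y\<bar>) \<bar>z\<bar> < 2 + sqrt 2"
    using surface_height_ge_imp[OF assms] by linarith
  with lattice_width_tetrahedron_le[of x y z] have "?w < 2 + sqrt 2" by linarith
  with False show ?thesis by simp
qed

end
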